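(* Let $\{A_n\}_{n\ge0}$ be a sequence of bounded self-adjoint operators on a complex Hilbert space $\mathcal{H}$ with $A_0=I$, admitting a minimal self-adjoint dilation $B\in\mathcal{B}(\mathcal{K})$ on some Hilbert space $\mathcal{K}\supseteq\mathcal{H}$. Then $\mathcal{K}$ decomposes as an orthogonal direct sum of Hilbert spaces $\mathcal{K}=\mathcal{H}_0\oplus\mathcal{H}_1\oplus\mathcal{H}_2\oplus\cdots$ with $\mathcal{H}_0=\mathcal{H}$, such that with respect to this decomposition $B$ has the block tri-diagonal form $$B=\begin{bmatrix} B_{00}&B_{10}^*&0&0&\cdots\\ B_{10}&B_{11}&B_{21}^*&0&\cdots\\ 0&B_{21}&B_{22}&B_{32}^*&\cdots\\ 0&0&B_{32}&B_{33}&\cdots\\ \vdots&\vdots&\vdots&\ddots&\ddots\end{bmatrix},$$ and $\mathcal{H}_n=\overline{B_{n(n-1)}(\mathcal{H}_{n-1})}$ for all $n\ge1$.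
   Context: A self-adjoint dilation of $\{A_n\}_{n\ge0}$ is a bounded self-adjoint operator $B$ on a Hilbert space $\mathcal{K}\supseteq\mathcal{H}$ such that $A_n=P_{\mathcal{H}}B^n|_{\mathcal{H}}$ for all $n\ge0$, with $P_{\mathcal{H}}$ the orthogonal projection onto $\mathcal{H}$; it is minimal if $\mathcal{K}=\overline{\mathrm{span}}\{B^nh:h\in\mathcal{H},n\ge0\}$. Here $B_{ij}:\mathcal{H}_j\to\mathcal{H}_i$ denotes the $(i,j)$ block of $B$. Some of the summands $\mathcal{H}_n$ may be $\{0\}$. *)

theory Defs
  imports "HOL-Analysis.Analysis"
begin

text \<open>
  Norm and topology come from the underlying real inner product space, whose inner product is
  the real part of the complex one. The complex inner product is linear in its first argument.
\<close>

class complex_inner = real_inner +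
  fixes scaleC :: "complex \<Rightarrow> 'a \<Rightarrow> 'a"  (infixr "*\<^sub>C" 75)
    and cinner :: "'a \<Rightarrow> 'a \<Rightarrow> complex"
  assumes scaleC_add_right: "a *\<^sub>C (x + y) = a *\<^sub>C x + a *\<^sub>C y"
    and scaleC_add_left: "(a + b) *\<^sub>C x = a *\<^sub>C x + b *\<^sub>C x"
    and scaleC_scaleC: "a *\<^sub>C (b *\<^sub>C x) = (a * b) *\<^sub>C x"
    and scaleC_one: "1 *\<^sub>C x = x"
    and scaleC_of_real: "complex_of_real r *\<^sub>C x = scaleR r x"
    and cinner_commute: "cinner x y = cnj (cinner y x)"
    and cinner_add_left: "cinner (x + y) z = cinner x z + cinner y z"
    and cinner_scaleC_left: "cinner (a *\<^sub>C x) y = a * cinner x y"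
    and Re_cinner: "Re (cinner x y) = inner x y"

class chilbert_space = complex_inner + complete_space

instantiation complex :: chilbert_space
begin

definition scaleC_complex :: "complex \<Rightarrow> complex \<Rightarrow> complex" where
  "scaleC_complex a x = a * x"

definition cinner_complex :: "complex \<Rightarrow> complex \<Rightarrow> complex" where
  "cinner_complex x y = x * cnj y"

instance
  by standard
    (simp_all add: scaleC_complex_def cinner_complex_def inner_complex_def algebra_simps
      scaleR_conv_of_real)

end

global_interpretation complex_vector: vector_space "scaleC :: complex \<Rightarrow> 'a \<Rightarrow> 'a::complex_inner"
  defines csubspace = complex_vector.subspace
    and cspan = complex_vector.span
  by standard (simp_all add: scaleC_add_right scaleC_add_left scaleC_scaleC scaleC_one)

definition hilbert_subspace :: "'a::chilbert_space set \<Rightarrow> bool" where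
  "hilbert_subspace S \<longleftrightarrow> csubspace S \<and> closed S"

text \<open>Operators between subspaces are total functions of which only the values on the domain
  subspace matter.\<close>

definition bounded_operator ::
    "'a::complex_inner set \<Rightarrow> 'a set \<Rightarrow> ('a \<Rightarrow> 'a) \<Rightarrow> bool" where
  "bounded_operator S T f \<longleftrightarrow>
     (\<forall>x\<in>S. f x \<in> T) \<and>
     (\<forall>x\<in>S. \<forall>y\<in>S. f (x + y) = f x + f y) \<and>
     (\<forall>c. \<forall>x\<in>S. f (c *\<^sub>C x) = c *\<^sub>C f x) \<and>
     (\<exists>M. \<forall>x\<in>S. norm (f x) \<le> M * norm x)"

definition is_adjoint ::
    "'a::complex_inner set \<Rightarrow> 'a set \<Rightarrow> ('a \<Rightarrow> 'a) \<Rightarrow> ('a \<Rightarrow> 'a) \<Rightarrow> bool" where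
  "is_adjoint S T f g \<longleftrightarrow>
     bounded_operator S T f \<and> bounded_operator T S g \<and>
     (\<forall>x\<in>S. \<forall>y\<in>T. cinner (f x) y = cinner x (g y))"

definition bounded_self_adjoint :: "'a::complex_inner set \<Rightarrow> ('a \<Rightarrow> 'a) \<Rightarrow> bool" where
  "bounded_self_adjoint S f \<longleftrightarrow> is_adjoint S S f f"

text \<open>The description is meaningful for closed subspaces \<open>S\<close> of a Hilbert space.\<close>

definition orth_proj :: "'a::complex_inner set \<Rightarrow> 'a \<Rightarrow> 'a" where
  "orth_proj S x = (THE y. y \<in> S \<and> (\<forall>z\<in>S. cinner (x - y) z = 0))"

definition self_adjoint_dilation ::
    "'a::chilbert_space set \<Rightarrow> (nat \<Rightarrow> 'a \<Rightarrow> 'a) \<Rightarrow> ('a \<Rightarrow> 'a) \<Rightarrow> bool" where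
  "self_adjoint_dilation H A B \<longleftrightarrow>
     bounded_self_adjoint UNIV B \<and>
     (\<forall>n. \<forall>h\<in>H. A n h = orth_proj H ((B ^^ n) h))"

definition minimal_self_adjoint_dilation ::
    "'a::chilbert_space set \<Rightarrow> (nat \<Rightarrow> 'a \<Rightarrow> 'a) \<Rightarrow> ('a \<Rightarrow> 'a) \<Rightarrow> bool" where
  "minimal_self_adjoint_dilation H A B \<longleftrightarrow>
     self_adjoint_dilation H A B \<and>
     closure (cspan {(B ^^ n) h | n h. h \<in> H}) = UNIV"

text \<open>Internal Hilbert direct sum. Orthogonality makes the expansion in the last clause unique,
  and completeness makes every square-summable family of components occur.\<close>

definition orthogonal_direct_sum :: "(nat \<Rightarrow> 'a::chilbert_space set) \<Rightarrow> bool" where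
  "orthogonal_direct_sum Hs \<longleftrightarrow>
     (\<forall>n. hilbert_subspace (Hs n)) \<and>
     (\<forall>m n. m \<noteq> n \<longrightarrow> (\<forall>x\<in>Hs m. \<forall>y\<in>Hs n. cinner x y = 0)) \<and>
     (\<forall>x. \<exists>f. (\<forall>n. f n \<in> Hs n) \<and> f sums x)"

text \<open>The block \<open>B\<^sub>i\<^sub>j\<close>, to be regarded as an operator from \<open>Hs j\<close> to \<open>Hs i\<close>; the column index
  only enters through that domain.\<close>

definition block ::
    "(nat \<Rightarrow> 'a::chilbert_space set) \<Rightarrow> ('a \<Rightarrow> 'a) \<Rightarrow> nat \<Rightarrow> nat \<Rightarrow> 'a \<Rightarrow> 'a" where
  "block Hs B i j = (\<lambda>x. if x \<in> Hs j then orth_proj (Hs i) (B x) else 0)"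

definition block_tridiagonal ::
    "(nat \<Rightarrow> 'a::chilbert_space set) \<Rightarrow> ('a \<Rightarrow> 'a) \<Rightarrow> bool" where
  "block_tridiagonal Hs B \<longleftrightarrow>
     (\<forall>i j. i + 1 < j \<or> j + 1 < i \<longrightarrow> (\<forall>x\<in>Hs j. block Hs B i j x = 0)) \<and>
     (\<forall>n. is_adjoint (Hs n) (Hs (n + 1)) (block Hs B (n + 1) n) (block Hs B n (n + 1)))"

end

theory Submission
  imports Defs
begin

text \<open>
  Let \<open>K\<^sub>n\<close> be the closed linear span of the spaces \<open>B\<^sup>k H\<close> with \<open>k \<le> n\<close>, and put
  \<open>H\<^sub>0 = H\<close> and \<open>H\<^sub>n\<^sub>+\<^sub>1 = K\<^sub>n\<^sub>+\<^sub>1 \<ominus> K\<^sub>n\<close>. Minimality says that the increasing sequence \<open>K\<^sub>n\<close> has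
  dense union, so the projections onto the \<open>K\<^sub>n\<close>, which are the partial sums of the projections
  onto the \<open>H\<^sub>n\<close>, converge strongly to the identity. Since \<open>B K\<^sub>n \<subseteq> K\<^sub>n\<^sub>+\<^sub>1\<close>, the blocks below the
  first subdiagonal vanish, and those above the first superdiagonal vanish because \<open>B\<close> is
  self-adjoint. A vector of \<open>H\<^sub>n\<^sub>+\<^sub>1\<close> orthogonal to \<open>B H\<^sub>n\<close> is orthogonal to \<open>K\<^sub>n + B K\<^sub>n\<close>,
  which is dense in \<open>K\<^sub>n\<^sub>+\<^sub>1\<close>, so it is zero.
\<close>

section \<open>Complex inner products and closed subspaces\<close>

lemma cinner_add_right: "cinner x (y + z) = cinner x y + cinner (x::'a::complex_inner) z"
  by (metis cinner_add_left cinner_commute complex_cnj_add)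

lemma cinner_scaleC_right: "cinner x (a *\<^sub>C y) = cnj a * cinner (x::'a::complex_inner) y"
  by (metis cinner_scaleC_left cinner_commute complex_cnj_mult)

lemma cinner_diff_left: "cinner (x - y) z = cinner x z - cinner (y::'a::complex_inner) z"
  by (metis add_diff_cancel_right' cinner_add_left diff_add_cancel)

lemma cinner_diff_right: "cinner x (y - z) = cinner x y - cinner (x::'a::complex_inner) z"
  by (metis add_diff_cancel_right' cinner_add_right diff_add_cancel)

lemma cinner_zero_left [simp]: "cinner 0 (x::'a::complex_inner) = 0"
  using cinner_diff_left[of x x x] by simp

lemma cinner_zero_right [simp]: "cinner (x::'a::complex_inner) 0 = 0"
  using cinner_diff_right[of x x x] by simp

text \<open>Conjugate linearity in the second argument turns the imaginary part into a real inner
  product with \<open>\<i> *\<^sub>C y\<close>. Complex orthogonality thus becomes two real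
  conditions.\<close>

lemma cinner_eq_inner:
  "cinner x y = Complex (inner x y) (inner (x::'a::complex_inner) (\<i> *\<^sub>C y))"
proof (rule complex_eqI)
  have "inner x (\<i> *\<^sub>C y) = Re (cnj \<i> * cinner x y)"
    by (metis Re_cinner cinner_scaleC_right)
  then show "Im (cinner x y) = Im (Complex (inner x y) (inner x (\<i> *\<^sub>C y)))"
    by simp
qed (simp add: Re_cinner)

lemma cinner_self_eq_0: "cinner x x = 0 \<longleftrightarrow> (x::'a::complex_inner) = 0"
  by (metis Re_cinner cinner_zero_left inner_eq_zero_iff zero_complex.sel(1))

text \<open>The norm belongs to the real structure, so its behaviour under complex scalars has to be
  derived from sesquilinearity.\<close>

lemma norm_scaleC: "norm (a *\<^sub>C (x::'a::complex_inner)) = cmod a * norm x"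
proof -
  have "cinner (a *\<^sub>C x) (a *\<^sub>C x) = (a * cnj a) * cinner x x"
    by (simp add: cinner_scaleC_left cinner_scaleC_right)
  then have "inner (a *\<^sub>C x) (a *\<^sub>C x) = Re (of_real ((cmod a)\<^sup>2) * cinner x x)"
    by (metis Re_cinner complex_norm_square of_real_power)
  also have "\<dots> = (cmod a)\<^sup>2 * inner x x"
    by (simp only: Re_complex_of_real Im_complex_of_real times_complex.sel Re_cinner mult_zero_left
        diff_zero)
  finally have "(norm (a *\<^sub>C x))\<^sup>2 = (cmod a * norm x)\<^sup>2"
    by (simp add: power2_norm_eq_inner power_mult_distrib)
  then show ?thesis
    by simp
qed

lemma csubspace_0: "csubspace S \<Longrightarrow> 0 \<in> S"
  and csubspace_add: "csubspace S \<Longrightarrow> x \<in> S \<Longrightarrow> y \<in> S \<Longrightarrow> x + y \<in> S"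
  and csubspace_diff: "csubspace S \<Longrightarrow> x \<in> S \<Longrightarrow> y \<in> S \<Longrightarrow> x - y \<in> S"
  and csubspace_scaleC: "csubspace S \<Longrightarrow> x \<in> S \<Longrightarrow> c *\<^sub>C x \<in> S"
  by (rule complex_vector.subspace_0 complex_vector.subspace_add complex_vector.subspace_diff
      complex_vector.subspace_scale; assumption)+

lemma csubspace_scaleR: "csubspace S \<Longrightarrow> x \<in> S \<Longrightarrow> r *\<^sub>R x \<in> S"
  by (metis csubspace_scaleC scaleC_of_real)

lemma bounded_linear_scaleC: "bounded_linear (\<lambda>x::'a::complex_inner. a *\<^sub>C x)"
proof (rule bounded_linear_intro)
  show "a *\<^sub>C (r *\<^sub>R x) = r *\<^sub>R (a *\<^sub>C x)" for r and x :: 'a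
    unfolding scaleC_of_real[symmetric] by (simp add: scaleC_scaleC mult.commute)
  show "norm (a *\<^sub>C x) \<le> norm x * cmod a" for x :: 'a
    by (simp add: norm_scaleC mult.commute)
qed (rule scaleC_add_right)

lemma csubspace_closure:
  fixes S :: "'a::complex_inner set"
  assumes S: "csubspace S"
  shows "csubspace (closure S)"
proof (rule complex_vector.subspaceI)
  show "0 \<in> closure S"
    using csubspace_0[OF S] closure_subset by blast
next
  fix x y assume "x \<in> closure S" "y \<in> closure S"
  then obtain f g where f: "\<And>n. f n \<in> S" "f \<longlonglongrightarrow> x" and g: "\<And>n. g n \<in> S" "g \<longlonglongrightarrow> y"
    unfolding closure_sequential by blast
  then have "\<forall>n. f n + g n \<in> S" "(\<lambda>n. f n + g n) \<longlonglongrightarrow> x + y"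
    using csubspace_add[OF S] by (auto intro: tendsto_add)
  then show "x + y \<in> closure S"
    unfolding closure_sequential by (intro exI[of _ "\<lambda>n. f n + g n"] conjI)
next
  fix c x assume "x \<in> closure S"
  then obtain f where f: "\<And>n. f n \<in> S" "f \<longlonglongrightarrow> x"
    unfolding closure_sequential by blast
  then have "\<forall>n. c *\<^sub>C f n \<in> S" "(\<lambda>n. c *\<^sub>C f n) \<longlonglongrightarrow> c *\<^sub>C x"
    using csubspace_scaleC[OF S] bounded_linear.tendsto[OF bounded_linear_scaleC] by auto
  then show "c *\<^sub>C x \<in> closure S"
    unfolding closure_sequential by (intro exI[of _ "\<lambda>n. c *\<^sub>C f n"] conjI)
qed

lemma hilbert_subspace_closure: "csubspace S \<Longrightarrow> hilbert_subspace (closure S)"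
  by (simp add: hilbert_subspace_def csubspace_closure)

text \<open>The complex equation splits into two real ones whose left sides are continuous in
  \<open>y\<close>.\<close>

lemma closed_orthogonal: "closed {y::'a::complex_inner. cinner x y = 0}"
proof -
  have "{y. cinner x y = 0} = {y. inner x y = 0 \<and> inner x (\<i> *\<^sub>C y) = 0}"
    by (simp add: cinner_eq_inner complex_eq_iff)
  moreover have "continuous_on UNIV (\<lambda>y::'a. \<i> *\<^sub>C y)"
    by (rule linear_continuous_on) (rule bounded_linear_scaleC)
  then have "closed {y. inner x y = 0 \<and> inner x (\<i> *\<^sub>C y) = 0}"
    by (intro closed_Collect_conj closed_Collect_eq continuous_intros)
  ultimately show ?thesis
    by simp
qed

lemma orthogonal_closure:
  assumes "\<And>y. y \<in> S \<Longrightarrow> cinner (x::'a::complex_inner) y = 0" "y \<in> closure S"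
  shows "cinner x y = 0"
  using closure_minimal[OF _ closed_orthogonal[of x], of S] assms by blast

lemma cinner_eq_0_sym: "cinner x y = 0 \<Longrightarrow> cinner y (x::'a::complex_inner) = 0"
  by (metis cinner_commute complex_cnj_zero)

lemma hilbert_subspace_complement:
  fixes S T :: "'a::chilbert_space set"
  assumes "hilbert_subspace S"
  shows "hilbert_subspace {x \<in> S. \<forall>z\<in>T. cinner x z = 0}"
proof -
  have "{x \<in> S. \<forall>z\<in>T. cinner x z = 0} = S \<inter> (\<Inter>z\<in>T. {x. cinner z x = 0})"
    by (auto intro: cinner_eq_0_sym)
  moreover have "closed \<dots>"
    using assms closed_orthogonal by (auto simp: hilbert_subspace_def)
  moreover have "csubspace {x \<in> S. \<forall>z\<in>T. cinner x z = 0}"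
    using assms by (auto simp: hilbert_subspace_def complex_vector.subspace_def cinner_add_left
        cinner_scaleC_left)
  ultimately show ?thesis
    by (simp add: hilbert_subspace_def)
qed

section \<open>Orthogonal projections\<close>

text \<open>A minimising sequence is Cauchy by the parallelogram law, since midpoints stay in
  \<open>S\<close> and cannot beat the infimum; completeness and closedness provide the
  limit.\<close>

lemma nearest_point_exists:
  fixes S :: "'a::chilbert_space set"
  assumes "hilbert_subspace S"
  shows "\<exists>y\<in>S. \<forall>z\<in>S. norm (x - y) \<le> norm (x - z)"
proof -
  have S: "csubspace S" "closed S"
    using assms by (auto simp: hilbert_subspace_def)
  define D where "D = (\<lambda>y. (norm (x - y))\<^sup>2) ` S"
  have D: "D \<noteq> {}" "bdd_below D"
    using csubspace_0[OF S(1)] by (auto simp: D_def intro!: bdd_belowI[of _ 0])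
  have lower: "Inf D \<le> (norm (x - y))\<^sup>2" if "y \<in> S" for y
    using cInf_lower[OF _ D(2)] that by (auto simp: D_def)
  have "\<exists>y\<in>S. (norm (x - y))\<^sup>2 < Inf D + inverse (Suc n)" for n
    using cInf_lessD[OF D(1), of "Inf D + inverse (Suc n)"] by (auto simp: D_def)
  then obtain y where y: "\<And>n. y n \<in> S" "\<And>n. (norm (x - y n))\<^sup>2 < Inf D + inverse (Suc n)"
    by metis
  \<comment> \<open>In the parallelogram law the midpoint term is at least \<open>4 * Inf D\<close>,
    which cancels the two contributions \<open>2 * Inf D\<close> and leaves only the errors.\<close>
  have gap: "(norm (y m - y n))\<^sup>2 \<le> 2 * inverse (Suc m) + 2 * inverse (Suc n)" for m n
  proof -
    have "(1/2) *\<^sub>R (y m + y n) \<in> S"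
      using y(1) S(1) by (intro csubspace_scaleR csubspace_add)
    then have "Inf D \<le> (norm (x - (1/2) *\<^sub>R (y m + y n)))\<^sup>2"
      by (rule lower)
    moreover have "(norm (y m - y n))\<^sup>2 = 2 * (norm (x - y m))\<^sup>2 + 2 * (norm (x - y n))\<^sup>2
        - 4 * (norm (x - (1/2) *\<^sub>R (y m + y n)))\<^sup>2"
    proof -
      have parallelogram: "(norm (b - a))\<^sup>2 = 2 * (norm a)\<^sup>2 + 2 * (norm b)\<^sup>2 - (norm (a + b))\<^sup>2"
        for a b :: 'a
        by (simp add: power2_norm_eq_inner inner_diff_left inner_diff_right inner_add_left
            inner_add_right inner_commute)
      have "(x - y m) + (x - y n) = 2 *\<^sub>R (x - (1/2) *\<^sub>R (y m + y n))"
        by (simp add: scaleR_diff_right scaleR_2)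
      then have "(norm ((x - y m) + (x - y n)))\<^sup>2 = 4 * (norm (x - (1/2) *\<^sub>R (y m + y n)))\<^sup>2"
        by (simp add: power_mult_distrib)
      then show ?thesis
        using parallelogram[of "x - y n" "x - y m"] by simp
    qed
    ultimately show ?thesis
      using y(2)[of m] y(2)[of n] by linarith
  qed
  have "Cauchy y"
  proof (rule metric_CauchyI)
    fix e :: real assume "e > 0"
    then obtain N where N: "inverse (Suc N) < e\<^sup>2 / 4"
      using reals_Archimedean[of "e\<^sup>2 / 4"] by auto
    have "dist (y m) (y n) < e" if "m \<ge> N" "n \<ge> N" for m n
    proof -
      have "inverse (real (Suc m)) \<le> inverse (Suc N)" "inverse (real (Suc n)) \<le> inverse (Suc N)"
        using that by (intro le_imp_inverse_le; simp)+
      then have "(norm (y m - y n))\<^sup>2 < e\<^sup>2"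
        using gap[of m n] N by linarith
      then show ?thesis
        using \<open>e > 0\<close> by (simp add: dist_norm power_less_imp_less_base)
    qed
    then show "\<exists>M. \<forall>m\<ge>M. \<forall>n\<ge>M. dist (y m) (y n) < e"
      by blast
  qed
  then obtain l where l: "y \<longlonglongrightarrow> l"
    using Cauchy_convergent convergent_def by blast
  have "l \<in> S"
    using closed_sequentially[OF S(2)] y(1) l by blast
  have lim: "(\<lambda>n. (norm (x - y n))\<^sup>2) \<longlonglongrightarrow> (norm (x - l))\<^sup>2"
    by (intro tendsto_intros l)
  have "(\<lambda>n. Inf D + inverse (real (Suc n))) \<longlonglongrightarrow> Inf D + 0"
    by (intro tendsto_add tendsto_const LIMSEQ_inverse_real_of_nat)
  then have "(norm (x - l))\<^sup>2 \<le> Inf D + 0"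
    by (rule LIMSEQ_le[OF lim]) (use y(2) less_imp_le in blast)
  then have "(norm (x - l))\<^sup>2 \<le> (norm (x - z))\<^sup>2" if "z \<in> S" for z
    using lower[OF that] by linarith
  then have "norm (x - l) \<le> norm (x - z)" if "z \<in> S" for z
    using that by (meson norm_ge_zero power2_le_imp_le)
  with \<open>l \<in> S\<close> show ?thesis
    by blast
qed

text \<open>First variation: a nonzero real inner product with some \<open>w\<close> in
  \<open>S\<close> would allow a closer point. Applying this to \<open>z\<close> and to
  \<open>\<i> *\<^sub>C z\<close> gives both parts of the complex inner product.\<close>

lemma nearest_point_orthogonal:
  fixes x y :: "'a::complex_inner"
  assumes S: "csubspace S" and y: "y \<in> S"
    and nearest: "\<And>z. z \<in> S \<Longrightarrow> norm (x - y) \<le> norm (x - z)" and z: "z \<in> S"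
  shows "cinner (x - y) z = 0"
proof -
  have *: "inner (x - y) w = 0" if w: "w \<in> S" for w
  proof (cases "w = 0")
    case False
    \<comment> \<open>This \<open>t\<close> minimises the quadratic
      \<open>norm (x - y - t *\<^sub>R w)\<close> squared.\<close>
    define t where "t = inner (x - y) w / inner w w"
    have "y + t *\<^sub>R w \<in> S"
      using w y S by (intro csubspace_add csubspace_scaleR)
    then have "(norm (x - y))\<^sup>2 \<le> (norm (x - (y + t *\<^sub>R w)))\<^sup>2"
      by (intro power_mono nearest) auto
    also have "x - (y + t *\<^sub>R w) = (x - y) - t *\<^sub>R w"
      by simp
    also have "(norm ((x - y) - t *\<^sub>R w))\<^sup>2
        = (norm (x - y))\<^sup>2 - 2 * t * inner (x - y) w + t * t * inner w w"
      unfolding power2_norm_eq_inner inner_diff_left[of "x - y"] inner_diff_right[of _ "x - y"]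
      by (simp add: inner_commute[of w "x - y"])
    also have "t * t * inner w w = t * inner (x - y) w"
      using False by (simp add: t_def)
    finally have "t * inner (x - y) w \<le> 0"
      by simp
    then have "(inner (x - y) w)\<^sup>2 / inner w w \<le> 0"
      by (simp add: t_def power2_eq_square)
    moreover have "inner w w > 0"
      using False by simp
    ultimately have "(inner (x - y) w)\<^sup>2 \<le> 0"
      by (simp add: divide_le_0_iff)
    then show ?thesis
      by simp
  qed simp
  show ?thesis
    using *[OF z] *[OF csubspace_scaleC[OF S z, of \<i>]]
    by (simp add: cinner_eq_inner complex_eq_iff)
qed

text \<open>The difference of two candidates lies in \<open>S\<close> and is orthogonal to
  \<open>S\<close>, hence to itself.\<close>

lemma orth_proj_unique:
  fixes x :: "'a::complex_inner"
  assumes "csubspace S" "y \<in> S" "\<And>z. z \<in> S \<Longrightarrow> cinner (x - y) z = 0"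
    "y' \<in> S" "\<And>z. z \<in> S \<Longrightarrow> cinner (x - y') z = 0"
  shows "y' = y"
proof -
  have "y' - y \<in> S"
    using assms by (intro csubspace_diff)
  then have "cinner ((x - y) - (x - y')) (y' - y) = 0"
    unfolding cinner_diff_left[of "x - y"] using assms by simp
  then show ?thesis
    by (simp add: cinner_self_eq_0)
qed

text \<open>Replaces the definite description by two checks, membership and orthogonality; every
  later formula for a projection is obtained this way.\<close>

lemma orth_proj_eqI:
  assumes "csubspace S" "y \<in> S" "\<And>z. z \<in> S \<Longrightarrow> cinner (x - y) z = 0"
  shows "orth_proj S x = y"
  unfolding orth_proj_def using assms by (intro the_equality) (auto intro: orth_proj_unique)

context
  fixes S :: "'a::chilbert_space set"
  assumes S: "hilbert_subspace S"
begin

lemma orth_proj_props: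
  "orth_proj S x \<in> S \<and> (\<forall>z\<in>S. cinner (x - orth_proj S x) z = 0)"
proof -
  have S': "csubspace S"
    using S by (simp add: hilbert_subspace_def)
  obtain y where y: "y \<in> S" "\<And>z. z \<in> S \<Longrightarrow> norm (x - y) \<le> norm (x - z)"
    using nearest_point_exists[OF S] by blast
  then have "\<And>z. z \<in> S \<Longrightarrow> cinner (x - y) z = 0"
    using nearest_point_orthogonal[OF S'] by blast
  then show ?thesis
    using y(1) orth_proj_eqI[OF S'] by auto
qed

lemma orth_proj_mem: "orth_proj S x \<in> S"
  using orth_proj_props by blast

lemma orth_proj_orthogonal: "z \<in> S \<Longrightarrow> cinner (x - orth_proj S x) z = 0"
  using orth_proj_props by blast

lemma cinner_orth_proj_left: "z \<in> S \<Longrightarrow> cinner (orth_proj S x) z = cinner x z"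
  using orth_proj_orthogonal[of z x] by (simp add: cinner_diff_left)

lemma cinner_orth_proj_right: "z \<in> S \<Longrightarrow> cinner z (orth_proj S x) = cinner z x"
  by (metis cinner_commute cinner_orth_proj_left)

text \<open>Pythagoras for \<open>x - orth_proj S x\<close> and \<open>orth_proj S x - z\<close>. It
  later yields convergence of the projections onto a growing sequence of subspaces.\<close>

lemma orth_proj_nearest:
  assumes "z \<in> S"
  shows "norm (x - orth_proj S x) \<le> norm (x - z)"
proof -
  have "orth_proj S x - z \<in> S"
    using assms S orth_proj_mem by (auto simp: hilbert_subspace_def intro: csubspace_diff)
  then have "inner (x - orth_proj S x) (orth_proj S x - z) = 0"
    by (metis Re_cinner orth_proj_orthogonal zero_complex.sel(1))
  then have "(norm ((x - orth_proj S x) + (orth_proj S x - z)))\<^sup>2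
      = (norm (x - orth_proj S x))\<^sup>2 + (norm (orth_proj S x - z))\<^sup>2"
    by (intro norm_add_Pythagorean) (simp add: orthogonal_def)
  then have "(norm (x - orth_proj S x))\<^sup>2 \<le> (norm (x - z))\<^sup>2"
    by simp
  then show ?thesis
    by (rule power2_le_imp_le) simp
qed

lemma norm_orth_proj_le: "norm (orth_proj S x) \<le> norm x"
proof -
  have "inner (x - orth_proj S x) (orth_proj S x) = 0"
    by (metis Re_cinner orth_proj_mem orth_proj_orthogonal zero_complex.sel(1))
  then have "(norm ((x - orth_proj S x) + orth_proj S x))\<^sup>2
      = (norm (x - orth_proj S x))\<^sup>2 + (norm (orth_proj S x))\<^sup>2"
    by (intro norm_add_Pythagorean) (simp add: orthogonal_def)
  then have "(norm (orth_proj S x))\<^sup>2 \<le> (norm x)\<^sup>2"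
    by simp
  then show ?thesis
    by (rule power2_le_imp_le) simp
qed

lemma orth_proj_add: "orth_proj S (x + y) = orth_proj S x + orth_proj S y"
proof (rule orth_proj_eqI)
  show "csubspace S"
    using S by (simp add: hilbert_subspace_def)
  then show "orth_proj S x + orth_proj S y \<in> S"
    by (intro csubspace_add orth_proj_mem)
qed (simp add: cinner_diff_left cinner_add_left cinner_orth_proj_left)

lemma orth_proj_scaleC: "orth_proj S (c *\<^sub>C x) = c *\<^sub>C orth_proj S x"
proof (rule orth_proj_eqI)
  show "csubspace S"
    using S by (simp add: hilbert_subspace_def)
  then show "c *\<^sub>C orth_proj S x \<in> S"
    by (intro csubspace_scaleC orth_proj_mem)
qed (simp add: cinner_diff_left cinner_scaleC_left cinner_orth_proj_left)

lemma orth_proj_eq_0: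
  assumes "\<And>z. z \<in> S \<Longrightarrow> cinner x z = 0"
  shows "orth_proj S x = 0"
  using assms S by (intro orth_proj_eqI) (auto simp: hilbert_subspace_def csubspace_0)

end

text \<open>The residual of a vector of \<open>S\<close> after projection onto
  \<open>closure T\<close> lies in \<open>S\<close> and is orthogonal to \<open>T\<close>, so it
  vanishes.\<close>

lemma dense_if_orthogonal_trivial:
  fixes T S :: "'a::chilbert_space set"
  assumes T: "csubspace T" "T \<subseteq> S" and S: "hilbert_subspace S"
    and trivial: "\<And>z. z \<in> S \<Longrightarrow> (\<And>t. t \<in> T \<Longrightarrow> cinner z t = 0) \<Longrightarrow> z = 0"
  shows "closure T = S"
proof
  show sub: "closure T \<subseteq> S"
    using S T by (intro closure_minimal) (auto simp: hilbert_subspace_def)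
  note cl = hilbert_subspace_closure[OF T(1)]
  show "S \<subseteq> closure T"
  proof
    fix y assume "y \<in> S"
    moreover have "orth_proj (closure T) y \<in> closure T"
      by (rule orth_proj_mem[OF cl])
    ultimately have "y - orth_proj (closure T) y \<in> S"
      using sub S by (auto simp: hilbert_subspace_def intro: csubspace_diff)
    then have "y - orth_proj (closure T) y = 0"
      using orth_proj_orthogonal[OF cl] closure_subset by (intro trivial) blast+
    then show "y \<in> closure T"
      using orth_proj_mem[OF cl, of y] by simp
  qed
qed

section \<open>Krylov filtration of a self-adjoint operator\<close>

text \<open>Closing up at every stage gives the closed span of the \<open>B ^^ k\<close> images of
  \<open>H\<close> with \<open>k \<le> n\<close> when \<open>H\<close> is a closed subspace and
  \<open>B\<close> is bounded linear. The recursive form supplies a dense set of vectors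
  \<open>x + B y\<close> from the previous stage.\<close>

primrec krylov :: "'a::chilbert_space set \<Rightarrow> ('a \<Rightarrow> 'a) \<Rightarrow> nat \<Rightarrow> 'a set" where
  "krylov H B 0 = H"
| "krylov H B (Suc n) = closure {x + B y | x y. x \<in> krylov H B n \<and> y \<in> krylov H B n}"

text \<open>If the filtration stabilises, the later differences are \<open>{0}\<close>, which the
  decomposition permits.\<close>

primrec krylov_step :: "'a::chilbert_space set \<Rightarrow> ('a \<Rightarrow> 'a) \<Rightarrow> nat \<Rightarrow> 'a set" where
  "krylov_step H B 0 = H"
| "krylov_step H B (Suc n) = {x \<in> krylov H B (Suc n). \<forall>z\<in>krylov H B n. cinner x z = 0}"

locale self_adjoint_on_subspace =
  fixes H :: "'a::chilbert_space set" and B :: "'a \<Rightarrow> 'a"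
  assumes H: "hilbert_subspace H" and B: "bounded_self_adjoint UNIV B"
begin

lemma B_add: "B (x + y) = B x + B y"
  and B_scaleC: "B (c *\<^sub>C x) = c *\<^sub>C B x"
  and B_adjoint: "cinner (B x) y = cinner x (B y)"
  using B by (auto simp: bounded_self_adjoint_def is_adjoint_def bounded_operator_def)

lemma B_0: "B 0 = 0"
  using B_add[of 0 0] by simp

lemma B_bounded: "\<exists>M. \<forall>x. norm (B x) \<le> M * norm x"
  using B by (auto simp: bounded_self_adjoint_def is_adjoint_def bounded_operator_def)

abbreviation "K \<equiv> krylov H B"
abbreviation "L \<equiv> krylov_step H B"

lemma hilbert_K: "hilbert_subspace (K n)"
proof (induction n)
  case (Suc n)
  then have K: "csubspace (K n)"
    by (simp add: hilbert_subspace_def)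
  let ?T = "{x + B y | x y. x \<in> K n \<and> y \<in> K n}"
  have "csubspace ?T"
  proof (rule complex_vector.subspaceI)
    have "0 + B 0 \<in> ?T"
      using csubspace_0[OF K] by blast
    then show "0 \<in> ?T"
      by (simp only: B_0 add_0)
  next
    fix u v assume "u \<in> ?T" "v \<in> ?T"
    then obtain x y x' y' where *: "u = x + B y" "v = x' + B y'" "x \<in> K n" "y \<in> K n"
        "x' \<in> K n" "y' \<in> K n"
      by blast
    then have "u + v = (x + x') + B (y + y')"
      by (simp add: B_add algebra_simps)
    then show "u + v \<in> ?T"
      using * csubspace_add[OF K] by blast
  next
    fix c u assume "u \<in> ?T"
    then obtain x y where *: "u = x + B y" "x \<in> K n" "y \<in> K n"
      by blast
    then have "c *\<^sub>C u = c *\<^sub>C x + B (c *\<^sub>C y)"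
      by (simp add: B_scaleC scaleC_add_right)
    then show "c *\<^sub>C u \<in> ?T"
      using * csubspace_scaleC[OF K] by blast
  qed
  then show ?case
    by (simp add: hilbert_subspace_closure)
qed (simp add: H)

lemma csubspace_K: "csubspace (K n)"
  using hilbert_K by (simp add: hilbert_subspace_def)

lemma K_generators:
  assumes "x \<in> K n" "y \<in> K n"
  shows "x + B y \<in> K (Suc n)"
  using assms closure_subset[of "{x + B y | x y. x \<in> K n \<and> y \<in> K n}"] by auto

lemma B_K: "y \<in> K n \<Longrightarrow> B y \<in> K (Suc n)"
  using K_generators[OF csubspace_0[OF csubspace_K]] by fastforce

lemma K_Suc: "K n \<subseteq> K (Suc n)"
  using K_generators[OF _ csubspace_0[OF csubspace_K]] B_0 by (metis add.right_neutral subsetI)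

lemma K_mono: "m \<le> n \<Longrightarrow> K m \<subseteq> K n"
  using lift_Suc_mono_le[of K] K_Suc by blast

section \<open>Orthogonal differences of the filtration\<close>

lemma hilbert_L: "hilbert_subspace (L n)"
  by (cases n) (simp_all add: H hilbert_subspace_complement hilbert_K del: krylov.simps(2))

lemma csubspace_L: "csubspace (L n)"
  using hilbert_L by (simp add: hilbert_subspace_def)

lemma L_subset_K: "L n \<subseteq> K n"
  by (cases n) (auto simp del: krylov.simps(2))

lemma L_orthogonal_K:
  assumes "x \<in> L n" "m < n" "z \<in> K m"
  shows "cinner x z = 0"
proof (cases n)
  case (Suc k)
  then have "z \<in> K k"
    using assms K_mono[of m k] by auto
  with Suc assms show ?thesis
    by simp
qed (use assms in simp)

lemma L_orthogonal:
  assumes "m \<noteq> n" "x \<in> L m" "y \<in> L n"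
  shows "cinner x y = 0"
proof (cases "m < n")
  case True
  then show ?thesis
    using L_orthogonal_K[OF assms(3)] L_subset_K assms(2) by (blast intro: cinner_eq_0_sym)
next
  case False
  then have "n < m"
    using assms by simp
  then show ?thesis
    using L_orthogonal_K[OF assms(2)] L_subset_K assms(3) by blast
qed

text \<open>With \<open>?v\<close> the right-hand side, \<open>x - ?v\<close> is the residual of
  \<open>x\<close> over \<open>K (Suc n)\<close> plus a vector of \<open>K n\<close>, and both are
  orthogonal to \<open>L (Suc n)\<close>.\<close>

lemma orth_proj_L_Suc:
  "orth_proj (L (Suc n)) x = orth_proj (K (Suc n)) x - orth_proj (K n) x"
proof (rule orth_proj_eqI)
  let ?v = "orth_proj (K (Suc n)) x - orth_proj (K n) x"
  show "csubspace (L (Suc n))"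
    by (rule csubspace_L)
  have "?v \<in> K (Suc n)"
    using K_Suc orth_proj_mem[OF hilbert_K] csubspace_diff[OF csubspace_K] by blast
  moreover have "cinner ?v z = 0" if "z \<in> K n" for z
  proof -
    have "z \<in> K (Suc n)"
      using that K_Suc by blast
    then show ?thesis
      using that by (simp add: cinner_diff_left cinner_orth_proj_left[OF hilbert_K]
          del: krylov.simps(2))
  qed
  ultimately show "?v \<in> L (Suc n)"
    by simp
  fix z assume z: "z \<in> L (Suc n)"
  then have "cinner z (orth_proj (K n) x) = 0"
    by (rule L_orthogonal_K[of _ _ n]) (auto intro: orth_proj_mem hilbert_K)
  then have "cinner (orth_proj (K n) x) z = 0"
    by (rule cinner_eq_0_sym)
  moreover have "z \<in> K (Suc n)"
    using z L_subset_K by blast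
  ultimately show "cinner (x - ?v) z = 0"
    by (simp add: cinner_diff_left cinner_orth_proj_left[OF hilbert_K] del: krylov.simps(2))
qed

text \<open>Telescoping, started by \<open>L 0 = K 0\<close>.\<close>

lemma sum_orth_proj_L: "(\<Sum>i<Suc n. orth_proj (L i) x) = orth_proj (K n) x"
proof (induction n)
  case (Suc n)
  then show ?case
    by (simp add: orth_proj_L_Suc del: krylov.simps(2) krylov_step.simps(2))
qed simp

text \<open>Projecting onto the previous stage gives \<open>u\<close>, and \<open>B\<close> raises
  the stage by at most one. Hence only the part \<open>v\<close> can be sent by \<open>B\<close>
  outside \<open>K n\<close>.\<close>

lemma K_split:
  assumes "w \<in> K n"
  obtains u v where "w = u + v" "v \<in> L n" "B u \<in> K n"
proof (cases n)
  case 0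
  \<comment> \<open>There is no previous stage here, so all of \<open>w\<close> goes into
    \<open>v\<close>.\<close>
  then have "w = 0 + w" "w \<in> L n" "B 0 \<in> K n"
    using assms H by (auto simp: B_0 hilbert_subspace_def csubspace_0)
  then show ?thesis
    by (rule that)
next
  case (Suc m)
  let ?u = "orth_proj (K m) w"
  have u: "?u \<in> K m"
    by (rule orth_proj_mem[OF hilbert_K])
  then have "w - ?u \<in> K n"
    using assms Suc K_Suc csubspace_diff[OF csubspace_K] by blast
  then have "w - ?u \<in> L n"
    using orth_proj_orthogonal[OF hilbert_K] Suc by simp
  moreover have "B ?u \<in> K n"
    using B_K[OF u] Suc by simp
  moreover have "w = ?u + (w - ?u)"
    by simp
  ultimately show ?thesis
    using that by blast
qed

section \<open>Density of the filtration and the orthogonal sum\<close>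

lemma power_mem_K: "h \<in> H \<Longrightarrow> (B ^^ n) h \<in> K n"
  by (induction n) (simp_all add: B_K del: krylov.simps(2))

text \<open>An increasing union of subspaces is a subspace: two vectors always share a stage. This
  transfers minimality to the filtration.\<close>

lemma cspan_subset_K: "cspan {(B ^^ n) h | n h. h \<in> H} \<subseteq> (\<Union>n. K n)"
proof (rule complex_vector.span_minimal)
  show "{(B ^^ n) h | n h. h \<in> H} \<subseteq> (\<Union>n. K n)"
    using power_mem_K by blast
  show "csubspace (\<Union>n. K n)"
  proof (rule complex_vector.subspaceI)
    show "0 \<in> (\<Union>n. K n)"
      using csubspace_0[OF csubspace_K] by blast
  next
    fix x y assume "x \<in> (\<Union>n. K n)" "y \<in> (\<Union>n. K n)"
    then obtain m n where "x \<in> K m" "y \<in> K n"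
      by blast
    then have "x \<in> K (max m n)" "y \<in> K (max m n)"
      using K_mono[of m "max m n"] K_mono[of n "max m n"] by auto
    then show "x + y \<in> (\<Union>n. K n)"
      using csubspace_add[OF csubspace_K] by blast
  next
    fix c x assume "x \<in> (\<Union>n. K n)"
    then show "c *\<^sub>C x \<in> (\<Union>n. K n)"
      using csubspace_scaleC[OF csubspace_K] by blast
  qed
qed

text \<open>Minimality enters as \<open>dense\<close>. The components of \<open>x\<close> are its
  projections; an approximant in \<open>K N\<close> stays in all later stages, where the projection
  of \<open>x\<close> is at least as close.\<close>

lemma orthogonal_direct_sum_L:
  assumes dense: "closure (\<Union>n. K n) = UNIV"
  shows "orthogonal_direct_sum L"
proof -
  have "(\<lambda>n. orth_proj (L n) x) sums x" for x
  proof -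
    have "(\<lambda>n. orth_proj (K n) x) \<longlonglongrightarrow> x"
    proof (rule metric_LIMSEQ_I)
      fix e :: real assume "e > 0"
      moreover have "x \<in> closure (\<Union>n. K n)"
        using dense by simp
      ultimately obtain u N where u: "u \<in> K N" "dist u x < e"
        unfolding closure_approachable by blast
      have "dist (orth_proj (K n) x) x < e" if "n \<ge> N" for n
      proof -
        have "u \<in> K n"
          using u(1) K_mono[OF that] by blast
        then have "norm (x - orth_proj (K n) x) \<le> norm (x - u)"
          by (rule orth_proj_nearest[OF hilbert_K])
        then show ?thesis
          using u(2) by (simp add: dist_norm norm_minus_commute)
      qed
      then show "\<exists>N. \<forall>n\<ge>N. dist (orth_proj (K n) x) x < e"
        by blast
    qed
    then have "(\<lambda>n. \<Sum>i<Suc n. orth_proj (L i) x) \<longlonglongrightarrow> x"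
      by (simp only: sum_orth_proj_L)
    \<comment> \<open>\<open>sums\<close> counts partial sums from the empty one, whereas the
      telescoped sums start with one term; the shift does not affect the limit.\<close>
    then show ?thesis
      unfolding sums_def by (rule LIMSEQ_imp_Suc)
  qed
  then have "\<exists>f. (\<forall>n. f n \<in> L n) \<and> f sums x" for x
    using orth_proj_mem[OF hilbert_L] by (intro exI[of _ "\<lambda>n. orth_proj (L n) x"]) simp
  moreover have "\<forall>m n. m \<noteq> n \<longrightarrow> (\<forall>x\<in>L m. \<forall>y\<in>L n. cinner x y = 0)"
    using L_orthogonal by blast
  ultimately show ?thesis
    by (simp only: orthogonal_direct_sum_def hilbert_L simp_thms)
qed

section \<open>Tridiagonal block form\<close>

lemma B_L_orthogonal_below:
  assumes "x \<in> L j" "Suc j < i" "z \<in> L i"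
  shows "cinner (B x) z = 0"
proof -
  have "B x \<in> K (Suc j)"
    using assms(1) L_subset_K B_K by blast
  then show ?thesis
    using L_orthogonal_K[OF assms(3,2)] by (blast intro: cinner_eq_0_sym)
qed

text \<open>Above the superdiagonal, self-adjointness moves \<open>B\<close> to the other argument
  and exchanges the roles of \<open>i\<close> and \<open>j\<close>.\<close>

lemma B_L_orthogonal:
  assumes "Suc i < j \<or> Suc j < i" "x \<in> L j" "z \<in> L i"
  shows "cinner (B x) z = 0"
  using assms(1)
proof
  assume "Suc i < j"
  then show ?thesis
    unfolding B_adjoint using B_L_orthogonal_below assms(2,3) by (blast intro: cinner_eq_0_sym)
qed (use B_L_orthogonal_below assms(2,3) in blast)

lemma bounded_operator_block: "bounded_operator (L j) (L i) (block L B i j)"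
proof -
  obtain M where M: "\<And>x. norm (B x) \<le> M * norm x"
    using B_bounded by blast
  have "norm (orth_proj (L i) (B x)) \<le> M * norm x" for x
    using norm_orth_proj_le[OF hilbert_L] M order_trans by blast
  then show ?thesis
    unfolding bounded_operator_def block_def
    \<comment> \<open>The guard in \<open>block\<close> holds at sums and multiples because
      \<open>L j\<close> is a subspace.\<close>
    using csubspace_L[of j]
    by (auto simp: orth_proj_mem[OF hilbert_L] B_add B_scaleC orth_proj_add[OF hilbert_L]
        orth_proj_scaleC[OF hilbert_L] csubspace_add csubspace_scaleC)
qed

text \<open>Each projection disappears when paired with a vector of its range, leaving the
  self-adjointness of \<open>B\<close>.\<close>

lemma is_adjoint_block: "is_adjoint (L j) (L i) (block L B i j) (block L B j i)"
  unfolding is_adjoint_def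
  by (auto simp: bounded_operator_block)
    (simp add: block_def cinner_orth_proj_left[OF hilbert_L] cinner_orth_proj_right[OF hilbert_L]
      B_adjoint)

lemma block_tridiagonal_L: "block_tridiagonal L B"
proof -
  have "block L B i j x = 0" if "i + 1 < j \<or> j + 1 < i" "x \<in> L j" for i j x
    using that B_L_orthogonal by (auto simp: block_def intro!: orth_proj_eq_0[OF hilbert_L])
  then show ?thesis
    unfolding block_tridiagonal_def using is_adjoint_block by blast
qed

text \<open>A vector \<open>z\<close> of \<open>L (Suc n)\<close> orthogonal to the image is
  orthogonal to \<open>B\<close> applied to \<open>L n\<close>, and by \<open>K_split\<close> to
  \<open>B\<close> applied to all of \<open>K n\<close>.\<close>

lemma block_image_dense: "closure (block L B (Suc n) n ` L n) = L (Suc n)"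
proof (rule dense_if_orthogonal_trivial)
  let ?T = "block L B (Suc n) n ` L n"
  have block: "block L B (Suc n) n x = orth_proj (L (Suc n)) (B x)" if "x \<in> L n" for x
    using that by (simp add: block_def)
  show "?T \<subseteq> L (Suc n)"
    using bounded_operator_block unfolding bounded_operator_def by blast
  show "hilbert_subspace (L (Suc n))"
    by (rule hilbert_L)
  have op: "\<And>x y. x \<in> L n \<Longrightarrow> y \<in> L n \<Longrightarrow>
        block L B (Suc n) n (x + y) = block L B (Suc n) n x + block L B (Suc n) n y"
      "\<And>c x. x \<in> L n \<Longrightarrow> block L B (Suc n) n (c *\<^sub>C x) = c *\<^sub>C block L B (Suc n) n x"
    using bounded_operator_block[of n "Suc n"] unfolding bounded_operator_def by blast+
  show "csubspace ?T"
  proof (rule complex_vector.subspaceI)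
    have "block L B (Suc n) n 0 = 0"
      using op(1)[OF csubspace_0[OF csubspace_L] csubspace_0[OF csubspace_L]] by simp
    then show "0 \<in> ?T"
      using csubspace_0[OF csubspace_L] by (metis imageI)
  next
    fix u v assume "u \<in> ?T" "v \<in> ?T"
    then obtain x y where "x \<in> L n" "y \<in> L n" "u = block L B (Suc n) n x"
        "v = block L B (Suc n) n y"
      by blast
    then show "u + v \<in> ?T"
      using op(1)[of x y] csubspace_add[OF csubspace_L] by (metis imageI)
  next
    fix c u assume "u \<in> ?T"
    then obtain x where "x \<in> L n" "u = block L B (Suc n) n x"
      by blast
    then show "c *\<^sub>C u \<in> ?T"
      using op(2)[of x c] csubspace_scaleC[OF csubspace_L] by (metis imageI)
  qed
  fix z assume z: "z \<in> L (Suc n)" and T: "\<And>t. t \<in> ?T \<Longrightarrow> cinner z t = 0"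
  have zK: "cinner z x = 0" if "x \<in> K n" for x
    using L_orthogonal_K[OF z _ that] by simp
  have zB: "cinner z (B w) = 0" if "w \<in> K n" for w
  proof -
    obtain u v where w: "w = u + v" "v \<in> L n" "B u \<in> K n"
      using \<open>w \<in> K n\<close> by (rule K_split)
    \<comment> \<open>Pairing with \<open>z\<close> cannot see the projection, so orthogonality to
      the block image controls \<open>B v\<close> itself.\<close>
    have "cinner z (B v) = cinner z (orth_proj (L (Suc n)) (B v))"
      by (rule cinner_orth_proj_right[OF hilbert_L z, symmetric])
    also have "\<dots> = 0"
      using T[of "block L B (Suc n) n v"] w(2) block[OF w(2)] by (metis imageI)
    finally show ?thesis
      using zK[OF w(3)] by (simp add: w(1) B_add cinner_add_right)
  qed
  \<comment> \<open>The generators orthogonal to \<open>z\<close> have \<open>z\<close> in their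
    closure, so \<open>z\<close> is orthogonal to itself.\<close>
  have "z \<in> closure {x + B y | x y. x \<in> K n \<and> y \<in> K n}"
    using z L_subset_K[of "Suc n"] by auto
  then have "cinner z z = 0"
    by (rule orthogonal_closure[rotated]) (auto simp: cinner_add_right zK zB)
  then show "z = 0"
    by (simp add: cinner_self_eq_0)
qed

end

theorem theorem2p6:
  fixes H :: "'k::chilbert_space set"
    and A :: "nat \<Rightarrow> 'k \<Rightarrow> 'k"
    and B :: "'k \<Rightarrow> 'k"
  assumes "hilbert_subspace H"
    and "\<And>n. bounded_self_adjoint H (A n)"
    and "\<And>h. h \<in> H \<Longrightarrow> A 0 h = h"
    and "minimal_self_adjoint_dilation H A B"
  shows "\<exists>Hs :: nat \<Rightarrow> 'k set.
           orthogonal_direct_sum Hs \<and>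
           Hs 0 = H \<and>
           block_tridiagonal Hs B \<and>
           (\<forall>n\<ge>1. Hs n = closure (block Hs B n (n - 1) ` Hs (n - 1)))"
proof -
  interpret self_adjoint_on_subspace H B
    using assms(1,4)
    by unfold_locales (auto simp: minimal_self_adjoint_dilation_def self_adjoint_dilation_def)
  have "closure (cspan {(B ^^ n) h | n h. h \<in> H}) = UNIV"
    using assms(4) by (simp add: minimal_self_adjoint_dilation_def)
  \<comment> \<open>The union contains the span that minimality makes dense.\<close>
  then have "closure (\<Union>n. K n) = UNIV"
    using closure_mono[OF cspan_subset_K] by auto
  then have "orthogonal_direct_sum L"
    by (rule orthogonal_direct_sum_L)
  moreover have "L n = closure (block L B n (n - 1) ` L (n - 1))" if "n \<ge> 1" for n
    using block_image_dense[of "n - 1"] that by simp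
  moreover have "L 0 = H"
    by simp
  ultimately show ?thesis
    using block_tridiagonal_L by blast
qed

end
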